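(* Fix fluid model data $(A,C,\Lambda,\nu,\vartheta)$, where $\Lambda$ is a weighted $\alpha$-fair bandwidth sharing policy with parameters $(\alpha,\kappa)$, $\alpha\in(0,\infty)$, $\kappa\in(0,\infty)^{\mathbf I}$. There exist invariant states for the fluid model if and only if $$A\rho\le C .$$ When $A\rho\le C$ holds, the set of invariant states is given by $$\mathcal M=\{\xi\in\mathbf M^{\mathbf I}:\ \xi_i=z_i\vartheta_i^e\ \text{for all } i\le\mathbf I\ \text{and some } z\in\mathcal P\},$$ where $\mathcal P=\{z\in\mathbb R_+^{\mathbf I}:\Lambda_i(z)=\rho_i\ \text{for all } i \text{ with } z_i>0\}$.
   Context: **Notation.** $\mathbf M$ is the set of finite nonnegative Borel measures on $\mathbb R_+=[0,\infty)$ with the topology of weak convergence; $\mathbf M^{\mathbf I}$ is its $\mathbf I$-fold product. $\langle f,\xi\rangle=\int f\,d\xi$, componentwise for vectors of measures; $\chi(x)=x$; $\|x\|=\max_i|x_i|$; vector inequalities are componentwise; $c/0=0$ for every real $c$. $\mathbf C_b^1(\mathbb R_+)$ is the set of $C^1$ functions on $\mathbb R_+$ that are bounded together with their first derivative, and $\mathcal C=\{f\in\mathbf C_b^1(\mathbb R_+):f(0)=f'(0)=0\}$. **Data.** $A$ is a $\mathbf J\times\mathbf I$ matrix with entries in $\{0,1\}$ and no column identically zero; $C\in\mathbb R_+^{\mathbf J}$ has strictly positive entries; $\nu=(\nu_1,\dots,\nu_{\mathbf I})$ has strictly positive entries; $\vartheta=(\vartheta_1,\dots,\vartheta_{\mathbf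 I})$ is a vector of Borel probability measures on $\mathbb R_+$ with $\langle\chi,\vartheta_i\rangle<\infty$ and $\langle1_{\{0\}},\vartheta_i\rangle=0$ for all $i$. Put $\mu_i=\langle\chi,\vartheta_i\rangle^{-1}$, $\rho_i=\nu_i/\mu_i$. For each $i$, $\vartheta_i^e$ is the excess lifetime distribution of $\vartheta_i$: the probability measure on $\mathbb R_+$ with density $p_i^e(x)=\mu_i\langle1_{(x,\infty)},\vartheta_i\rangle$, $x\in\mathbb R_+$. **Weighted $\alpha$-fair policy.** For $z\in\mathbb R_+^{\mathbf I}$ let $\mathcal I_+(z)=\{i:z_i>0\}$ and $\mathbb O(z)=\{\lambda\in\mathbb R_+^{\mathbf I}:\lambda_i=0\text{ whenever }z_i=0\}$. Define $G_z:\mathbb R_+^{\mathbf I}\to[-\infty,\infty)$ by $G_z(\lambda)=\sum_{i\in\mathcal I_+(z)}\kappa_iz_i^\alpha\frac{\lambda_i^{1-\alpha}}{1-\alpha}$ if $\alpha\ne1$ and $G_z(\lambda)=\sum_{i\in\mathcal I_+(z)}\kappa_iz_i\log\lambda_i$ if $\alpha=1$, with value $-\infty$ if $\alpha\ge1$ and $\lambda_i=0$ for some $i\in\mathcal I_+(z)$, and $G_z(\lambda)=0$ if $\mathcal I_+(z)=\varnothing$. $\Lambda(z)$ is the unique maximizer of $G_z(\lambda)$ over $\lambda\in\mathbb O(z)$ subject to $A\lambda\le C$. It is known that $\Lambda$ is a bandwidth sharing policy, i.e. for each $z$: $\Lambda_i(z)>0$ if $z_i>0$; $\Lambda_i(z)=0$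 if $z_i=0$; $A\Lambda(z)\le C$; $\Lambda(rz)=\Lambda(z)$ for $r>0$; and each $\Lambda_i$ is continuous on $\{z\in\mathbb R_+^{\mathbf I}:z_i>0\}$. **Fluid model.** Given a continuous $\zeta:[0,\infty)\to\mathbf M^{\mathbf I}$, put $z(t)=\langle1,\zeta(t)\rangle$; $\tau_i(t)=\int_0^t(\Lambda_i(z(s))1_{(0,\infty)}(z_i(s))+\rho_i1_{\{0\}}(z_i(s)))\,ds$; $u(t)=Ct-A\tau(t)$. A fluid model solution for the data $(A,C,\Lambda,\nu,\vartheta)$ is a continuous $\zeta:[0,\infty)\to\mathbf M^{\mathbf I}$ such that: (i) $\|\langle1_{\{0\}},\zeta(t)\rangle\|=0$ for all $t\ge0$; (ii) $u_j$ is nondecreasing for all $j\le\mathbf J$; (iii) for each $f\in\mathcal C$, $i\le\mathbf I$, $t\ge0$, $$\langle f,\zeta_i(t)\rangle=\langle f,\zeta_i(0)\rangle-\int_0^t\langle f',\zeta_i(s)\rangle\frac{\Lambda_i(z(s))}{z_i(s)}\,ds+\nu_i\langle f,\vartheta_i\rangle\int_0^t1_{(0,\infty)}(z_i(s))\,ds,$$ where the integrand of the first integral is $0$ when $z_i(s)=0$. **Invariant state.** $\xi\in\mathbf M^{\mathbf I}$ is an invariant state for the fluid model if there is a fluid model solution $\zeta(\cdot)$ with $\zeta(t)=\xi$ for all $t\ge0$. *)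

theory Defs
  imports "HOL-Probability.Probability"
begin

(* Measures on [0,oo) have {0..} as their space, so integrals never see the values of an
   integrand outside {0..}, and functions on [0,oo) are rendered as functions real => real. *)

abbreviation borel_nonneg :: "real measure" where
  "borel_nonneg \<equiv> restrict_space borel {0..}"

definition fin_measures :: "real measure set" where
  "fin_measures = {\<xi>. sets \<xi> = sets borel_nonneg \<and> finite_measure \<xi>}"

(* The coarsest topology on fin_measures that makes integration against every bounded
   continuous function on [0,oo) continuous. *)
definition weak_topology :: "real measure topology" where
  "weak_topology = topology_generated_by
     {{\<xi> \<in> fin_measures. (\<integral>x. f x \<partial>\<xi>) \<in> U} | (f :: real \<Rightarrow> real) U.
        continuous_on {0..} f \<and> bounded (f ` {0..}) \<and> open U}"

lemma topspace_weak_topology: "topspace weak_topology = fin_measures"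
proof -
  have "fin_measures \<in> {{\<xi> \<in> fin_measures. (\<integral>x. f x \<partial>\<xi>) \<in> U} | (f :: real \<Rightarrow> real) U.
        continuous_on {0..} f \<and> bounded (f ` {0..}) \<and> open U}"
    by (rule CollectI, rule exI[of _ "\<lambda>_. 0"], rule exI[of _ UNIV])
       (auto simp: image_constant_conv)
  then show ?thesis
    unfolding weak_topology_def topology_generated_by_topspace by blast
qed

(* Pairs of a function and its derivative, one-sided at 0. *)
definition Cb1 :: "((real \<Rightarrow> real) \<times> (real \<Rightarrow> real)) set" where
  "Cb1 = {(f, f'). (\<forall>x\<ge>0. (f has_real_derivative f' x) (at x within {0..})) \<and>
            continuous_on {0..} f' \<and> bounded (f ` {0..}) \<and> bounded (f' ` {0..})}"

definition test_class :: "((real \<Rightarrow> real) \<times> (real \<Rightarrow> real)) set" where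
  "test_class = {(f, f') \<in> Cb1. f 0 = 0 \<and> f' 0 = 0}"

definition rate :: "real measure \<Rightarrow> real" where
  "rate \<theta> = inverse (\<integral>x. x \<partial>\<theta>)"

definition load :: "real^'i \<Rightarrow> ('i::finite \<Rightarrow> real measure) \<Rightarrow> real^'i" where
  "load \<nu> \<theta> = (\<chi> i. \<nu> $ i / rate (\<theta> i))"

definition excess_lifetime :: "real measure \<Rightarrow> real measure" where
  "excess_lifetime \<theta> =
     density (restrict_space lborel {0..}) (\<lambda>x. ennreal (rate \<theta> * measure \<theta> {x<..}))"

definition fair_utility ::
    "real \<Rightarrow> real^'i \<Rightarrow> real^'i \<Rightarrow> real^'i::finite \<Rightarrow> ereal" where
  "fair_utility \<alpha> \<kappa> z l =
     (if \<alpha> \<ge> 1 \<and> (\<exists>i. z $ i > 0 \<and> l $ i = 0) then -\<infinity>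
      else if \<alpha> = 1 then ereal (\<Sum>i | z $ i > 0. \<kappa> $ i * z $ i * ln (l $ i))
      else ereal (\<Sum>i | z $ i > 0.
             \<kappa> $ i * (z $ i) powr \<alpha> * ((l $ i) powr (1 - \<alpha>) / (1 - \<alpha>))))"

definition admissible :: "real^'i \<Rightarrow> (real^'i::finite) set" where
  "admissible z = {l. 0 \<le> l \<and> (\<forall>i. z $ i = 0 \<longrightarrow> l $ i = 0)}"

(* The value of the policy is the unique maximizer; it is unconstrained outside the
   nonnegative orthant. *)
definition alpha_fair_policy ::
    "real^'i^'j \<Rightarrow> real^'j \<Rightarrow> real \<Rightarrow> real^'i
      \<Rightarrow> (real^'i::finite \<Rightarrow> real^'i) \<Rightarrow> bool" where
  "alpha_fair_policy A C \<alpha> \<kappa> \<Lambda> \<longleftrightarrow>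
     (\<forall>z\<ge>0. \<forall>l. is_arg_max (fair_utility \<alpha> \<kappa> z) (\<lambda>l. l \<in> admissible z \<and> A *v l \<le> C) l
                  \<longleftrightarrow> l = \<Lambda> z)"

definition mass :: "('i::finite \<Rightarrow> real measure) \<Rightarrow> real^'i" where
  "mass \<xi> = (\<chi> i. \<integral>x. 1 \<partial>\<xi> i)"

definition cumulative_allocation ::
    "(real^'i \<Rightarrow> real^'i) \<Rightarrow> real^'i \<Rightarrow> ('i::finite \<Rightarrow> real measure)
      \<Rightarrow> (real \<Rightarrow> 'i \<Rightarrow> real measure) \<Rightarrow> real \<Rightarrow> real^'i" where
  "cumulative_allocation \<Lambda> \<nu> \<theta> \<zeta> t =
     (\<chi> i. LBINT s:{0..t}.
        \<Lambda> (mass (\<zeta> s)) $ i * indicator {0<..} (mass (\<zeta> s) $ i)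
        + load \<nu> \<theta> $ i * indicator {0} (mass (\<zeta> s) $ i))"

definition unused_capacity ::
    "real^'i^'j \<Rightarrow> real^'j \<Rightarrow> (real^'i \<Rightarrow> real^'i) \<Rightarrow> real^'i
      \<Rightarrow> ('i::finite \<Rightarrow> real measure) \<Rightarrow> (real \<Rightarrow> 'i \<Rightarrow> real measure) \<Rightarrow> real \<Rightarrow> real^'j" where
  "unused_capacity A C \<Lambda> \<nu> \<theta> \<zeta> t = t *\<^sub>R C - A *v cumulative_allocation \<Lambda> \<nu> \<theta> \<zeta> t"

(* Division by zero is zero, so the integrand of the first time integral vanishes when
   mass (\<zeta> s) $ i = 0.  infnorm is the maximum norm. *)
definition fluid_model_solution ::
    "real^'i^'j \<Rightarrow> real^'j \<Rightarrow> (real^'i \<Rightarrow> real^'i) \<Rightarrow> real^'i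
      \<Rightarrow> ('i::finite \<Rightarrow> real measure) \<Rightarrow> (real \<Rightarrow> 'i \<Rightarrow> real measure) \<Rightarrow> bool" where
  "fluid_model_solution A C \<Lambda> \<nu> \<theta> \<zeta> \<longleftrightarrow>
     continuous_map (top_of_set {0..}) (product_topology (\<lambda>_. weak_topology) UNIV) \<zeta> \<and>
     (\<forall>t\<ge>0. infnorm ((\<chi> i. \<integral>x. indicator {0} x \<partial>\<zeta> t i) :: real^'i) = 0) \<and>
     (\<forall>j. mono_on {0..} (\<lambda>t. unused_capacity A C \<Lambda> \<nu> \<theta> \<zeta> t $ j)) \<and>
     (\<forall>(f, f') \<in> test_class. \<forall>i. \<forall>t\<ge>0.
        (\<integral>x. f x \<partial>\<zeta> t i) =
          (\<integral>x. f x \<partial>\<zeta> 0 i)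
          - (LBINT s:{0..t}. (\<integral>x. f' x \<partial>\<zeta> s i) * (\<Lambda> (mass (\<zeta> s)) $ i / mass (\<zeta> s) $ i))
          + \<nu> $ i * (\<integral>x. f x \<partial>\<theta> i) * (LBINT s:{0..t}. indicator {0<..} (mass (\<zeta> s) $ i)))"

definition invariant_state ::
    "real^'i^'j \<Rightarrow> real^'j \<Rightarrow> (real^'i \<Rightarrow> real^'i) \<Rightarrow> real^'i
      \<Rightarrow> ('i::finite \<Rightarrow> real measure) \<Rightarrow> ('i \<Rightarrow> real measure) \<Rightarrow> bool" where
  "invariant_state A C \<Lambda> \<nu> \<theta> \<xi> \<longleftrightarrow>
     (\<forall>i. \<xi> i \<in> fin_measures) \<and>
     (\<exists>\<zeta>. fluid_model_solution A C \<Lambda> \<nu> \<theta> \<zeta> \<and> (\<forall>t\<ge>0. \<zeta> t = \<xi>))"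

definition equilibrium_masses ::
    "(real^'i \<Rightarrow> real^'i) \<Rightarrow> real^'i \<Rightarrow> ('i::finite \<Rightarrow> real measure) \<Rightarrow> (real^'i) set" where
  "equilibrium_masses \<Lambda> \<nu> \<theta> =
     {z. 0 \<le> z \<and> (\<forall>i. z $ i > 0 \<longrightarrow> \<Lambda> z $ i = load \<nu> \<theta> $ i)}"

definition invariant_manifold ::
    "(real^'i \<Rightarrow> real^'i) \<Rightarrow> real^'i \<Rightarrow> ('i::finite \<Rightarrow> real measure)
      \<Rightarrow> ('i \<Rightarrow> real measure) set" where
  "invariant_manifold \<Lambda> \<nu> \<theta> =
     {\<xi>. (\<forall>i. \<xi> i \<in> fin_measures) \<and>
          (\<exists>z \<in> equilibrium_masses \<Lambda> \<nu> \<theta>.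
             \<forall>i. \<xi> i = scale_measure (ennreal (z $ i)) (excess_lifetime (\<theta> i)))}"

end

theory Submission
  imports Defs
begin

text \<open>For a constant path with masses \<open>z\<close> every time integral is linear in \<open>t\<close>, so the fluid
  equation becomes \<open>\<langle>f', \<xi>\<^sub>i\<rangle> \<Lambda>\<^sub>i(z) / z\<^sub>i = \<nu>\<^sub>i \<langle>f, \<theta>\<^sub>i\<rangle>\<close> whenever \<open>z\<^sub>i > 0\<close>.  By Fubini the right-hand
  side is \<open>\<rho>\<^sub>i\<close> times the integral of \<open>f'\<close> against the excess lifetime distribution.  Since the
  derivatives \<open>f'\<close> approximate the indicators of \<open>(a, \<infinity>)\<close>, the finite measures \<open>(\<Lambda>\<^sub>i(z) / z\<^sub>i) \<xi>\<^sub>i\<close> and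
  \<open>\<rho>\<^sub>i \<theta>\<^sub>i\<^sup>e\<close> coincide; comparing total masses gives \<open>\<Lambda>\<^sub>i(z) = \<rho>\<^sub>i\<close>, and then \<open>\<xi>\<^sub>i = z\<^sub>i \<theta>\<^sub>i\<^sup>e\<close>.  So the
  allocation process of an invariant state is \<open>\<rho> t\<close>, and the capacity constraint is \<open>A \<rho> \<le> C\<close>.  Of the
  policy only the nonnegativity of \<open>\<Lambda>(z)\<close> enters.\<close>

section \<open>Borel sets and measurability on the half line\<close>

lemma borel_nonneg_space: "sets M = sets borel_nonneg \<Longrightarrow> space M = {0..}"
  by (metis sets_eq_imp_space_eq space_restrict_space2 sets_borel atLeast_borel)

lemma borel_nonneg_setsD: "sets M = sets borel_nonneg \<Longrightarrow> X \<in> sets M \<Longrightarrow> X \<in> sets borel \<and> X \<subseteq> {0..}"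
  by (auto simp: sets_restrict_space_iff)

lemma borel_nonneg_setsI: "sets M = sets borel_nonneg \<Longrightarrow> X \<in> sets borel \<Longrightarrow> X \<subseteq> {0..} \<Longrightarrow> X \<in> sets M"
  by (auto simp: sets_restrict_space_iff)

lemma borel_nonneg_measurable_id:
  "sets M = sets borel_nonneg \<Longrightarrow> (\<lambda>x. x) \<in> measurable M borel"
  by (subst measurable_cong_sets[of M borel_nonneg borel borel])
     (auto intro: measurable_restrict_space1)

lemma borel_nonneg_measurable_continuous_on:
  fixes f :: "real \<Rightarrow> real"
  assumes "sets M = sets borel_nonneg" "continuous_on {0..} f"
  shows "f \<in> borel_measurable M"
  using assms(1) borel_measurable_continuous_on_restrict[OF assms(2)]
  by (simp add: measurable_cong_sets[of M borel_nonneg borel borel])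

section \<open>Derivatives of test functions determine a measure\<close>

text \<open>Supplies test functions with a prescribed derivative. The primitive has slope between 0
  and 1 and is constant beyond \<open>\<bar>b\<bar>\<close>, so it stays between 0 and
  \<open>\<bar>b\<bar>\<close>.\<close>

lemma primitive_in_test_class:
  fixes h :: "real \<Rightarrow> real"
  assumes cont: "continuous_on {0..} h" and zero: "h 0 = 0"
    and nonneg: "\<And>x. 0 \<le> h x" and le1: "\<And>x. h x \<le> 1" and supp: "\<And>x. x > b \<Longrightarrow> h x = 0"
  shows "(\<lambda>x. integral {0..x} h, h) \<in> test_class"
proof -
  define F where "F = (\<lambda>x. integral {0..x} h)"
  have int: "h integrable_on {u..v}" if "0 \<le> u" for u v
    by (rule integrable_continuous_real) (use that in \<open>auto intro: continuous_on_subset[OF cont]\<close>)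
  have der: "(F has_real_derivative h x) (at x within {0..})" if "x \<ge> 0" for x
  proof -
    \<comment> \<open>The fundamental theorem is applied on a compact interval; the right end
      \<open>x + 1\<close> keeps \<open>x\<close> away from it, so near \<open>x\<close> the
      interval agrees with the half line.\<close>
    have "(F has_real_derivative h x) (at x within {0..x + 1})"
      unfolding F_def
      by (rule integral_has_real_derivative) (use that in \<open>auto intro: continuous_on_subset[OF cont]\<close>)
    moreover have "at x within {0..x + 1} = at x within {0..}"
      by (rule at_within_nhd[of _ "{..<x + 1}"]) auto
    ultimately show ?thesis by simp
  qed
  have "\<bar>F x\<bar> \<le> \<bar>b\<bar>" if "x \<ge> 0" for x
  proof -
    have le: "F u \<le> u" if "u \<ge> 0" for u
      unfolding F_def
      using integral_le[OF int[of 0 u] integrable_const_ivl[of 1 0 u]] le1 that by auto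
    have "F x \<le> \<bar>b\<bar>"
    proof (cases "x \<le> \<bar>b\<bar>")
      case True
      then show ?thesis using le[OF that] by simp
    next
      case False
      have "F x = F \<bar>b\<bar> + integral {\<bar>b\<bar>..x} h"
        unfolding F_def by (rule Henstock_Kurzweil_Integration.integral_combine[symmetric]) (use False int in auto)
      \<comment> \<open>\<open>supp\<close> gives zeros only strictly beyond \<open>b\<close>; the
        point \<open>b\<close> itself is discarded as a null set.\<close>
      moreover have "integral {\<bar>b\<bar>..x} h = integral {\<bar>b\<bar>..x} (\<lambda>_. 0)"
        by (rule integral_spike[of "{b}"]) (use supp in force)+
      ultimately show ?thesis using le[of "\<bar>b\<bar>"] by simp
    qed
    moreover have "0 \<le> F x"
      unfolding F_def by (rule integral_nonneg) (use int nonneg in auto)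
    ultimately show ?thesis by simp
  qed
  then have "bounded (F ` {0..})" by (auto simp: bounded_iff)
  moreover have "bounded (h ` {0..})"
    unfolding bounded_iff by (rule exI[of _ 1]) (use nonneg le1 in auto)
  moreover have "F 0 = 0" by (simp add: F_def)
  ultimately show ?thesis
    using der cont zero unfolding test_class_def Cb1_def F_def by auto
qed

text \<open>The tails over \<open>{a<..}\<close> with \<open>a \<ge> 0\<close> are limits of
  integrals of admissible derivatives, and they determine the measure on the open half line. Every
  such derivative vanishes at 0, so an atom there would go unnoticed; this is why both measures are
  assumed to have none.\<close>

lemma measure_eq_if_test_class_eq:
  assumes M: "sets M = sets borel_nonneg" "finite_measure M" "measure M {0} = 0"
    and N: "sets N = sets borel_nonneg" "finite_measure N" "measure N {0} = 0"
    and eq: "\<And>f f'. (f, f') \<in> test_class \<Longrightarrow> (\<integral>x. f' x \<partial>M) = (\<integral>x. f' x \<partial>N)"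
  shows "M = N"
proof -
  have tail: "measure M {a<..} = measure N {a<..}" if a: "a \<ge> 0" for a :: real
  proof -
    \<comment> \<open>The first factor rises from 0 at \<open>a\<close> to 1 with slope
      \<open>n\<close>. The second is 1 up to \<open>n - 1\<close> and 0 from \<open>n\<close> on;
      this cutoff keeps the primitive bounded.\<close>
    define h :: "nat \<Rightarrow> real \<Rightarrow> real" where
      "h n x = max 0 (min 1 (real n * (x - a))) * max 0 (min 1 (real n - x))" for n x
    have cont: "continuous_on {0..} (h n)" for n
      unfolding h_def by (intro continuous_intros)
    have h0: "0 \<le> h n x" and h1: "h n x \<le> 1" for n x
      unfolding h_def by (auto intro!: mult_le_one)
    have left: "h n x = 0" if "x \<le> a" for n x
      using mult_nonneg_nonpos[of "real n" "x - a"] that by (simp add: h_def)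
    have right: "h n x = 0" if "x > real n" for n x
      using that by (simp add: h_def)
    have lim: "(\<lambda>n. h n x) \<longlonglongrightarrow> indicator {a<..} x" for x
    proof (cases "x > a")
      case False
      then show ?thesis using left False by simp
    next
      case True
      \<comment> \<open>The two thresholds make the first and the second factor of
        \<open>h n x\<close> equal to 1.\<close>
      have "\<forall>\<^sub>F n in sequentially. 1 / (x - a) \<le> real n \<and> x + 1 \<le> real n"
        by (intro eventually_conj eventually_compose_filterlim[OF eventually_ge_at_top filterlim_real_sequentially])
      then have "\<forall>\<^sub>F n in sequentially. h n x = 1"
        by eventually_elim (use True in \<open>simp add: h_def field_simps\<close>)
      then show ?thesis using True by (simp add: tendsto_eventually)
    qed
    have conv: "(\<lambda>n. \<integral>x. h n x \<partial>K) \<longlonglongrightarrow> measure K {a<..}"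
      if K: "sets K = sets borel_nonneg" "finite_measure K" for K
    proof -
      have "{a<..} \<in> sets K" by (rule borel_nonneg_setsI[OF K(1)]) (use a in auto)
      moreover have "(\<lambda>n. \<integral>x. h n x \<partial>K) \<longlonglongrightarrow> (\<integral>x. indicator {a<..} x \<partial>K)"
      proof (rule integral_dominated_convergence[where w = "\<lambda>_. 1"])
        show "integrable K (\<lambda>_. 1 :: real)" using K(2) by (simp add: finite_measure.integrable_const)
        show "h n \<in> borel_measurable K" for n
          by (rule borel_nonneg_measurable_continuous_on[OF K(1) cont])
        show "indicat_real {a<..} \<in> borel_measurable K" using calculation by simp
      qed (use lim h0 h1 in auto)
      ultimately show ?thesis using sets.sets_into_space by (auto simp: Int_absorb2)
    qed
    have "(\<lambda>x. integral {0..x} (h n), h n) \<in> test_class" for n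
      by (rule primitive_in_test_class[where b = "real n"])
         (use cont h0 h1 left right a in auto)
    then have "(\<integral>x. h n x \<partial>M) = (\<integral>x. h n x \<partial>N)" for n by (rule eq)
    then show ?thesis
      using conv[OF M(1,2)] conv[OF N(1,2)] LIMSEQ_unique by auto
  qed
  \<comment> \<open>Both measures are pushed forward to the whole line, where agreement on open
    right rays implies equality.\<close>
  have distr: "emeasure (distr K borel (\<lambda>x. x)) X = emeasure K (X \<inter> {0..})"
    if "sets K = sets borel_nonneg" "X \<in> sets borel" for K and X :: "real set"
    using that borel_nonneg_measurable_id[OF that(1)] borel_nonneg_space[OF that(1)]
    by (subst emeasure_distr) auto
  have total: "measure K {0..} = measure K {0<..}"
    if K: "sets K = sets borel_nonneg" "finite_measure K" "measure K {0} = 0" for K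
  proof -
    have "measure K ({0} \<union> {0<..}) = measure K {0} + measure K {0<..}"
      by (rule finite_measure.finite_measure_Union[OF K(2)])
         (auto intro: borel_nonneg_setsI[OF K(1)])
    moreover have "{0} \<union> {0<..} = {0 :: real..}" by auto
    ultimately show ?thesis using K(3) by simp
  qed
  \<comment> \<open>For \<open>a < 0\<close> the ray covers the whole half line, whose measure
    equals that of \<open>{0<..}\<close> since there is no atom at 0.\<close>
  have "measure M ({a<..} \<inter> {0..}) = measure N ({a<..} \<inter> {0..})" for a
  proof (cases "a \<ge> 0")
    case True
    then have "{a<..} \<inter> {0..} = {a<..}" by auto
    then show ?thesis using tail[OF True] by simp
  next
    case False
    then have "{a<..} \<inter> {0..} = {0..}" by auto
    then show ?thesis using tail[of 0] total[OF M] total[OF N] by simp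
  qed
  then have "emeasure M ({a<..} \<inter> {0..}) = emeasure N ({a<..} \<inter> {0..})" for a
    using M(2) N(2) by (simp add: finite_measure.emeasure_eq_measure)
  then have eq': "distr M borel (\<lambda>x. x) = distr N borel (\<lambda>x. x)"
    by (intro measure_eqI_lessThan)
       (auto simp: distr[OF M(1)] distr[OF N(1)] finite_measure.emeasure_eq_measure[OF N(2)])
  show ?thesis
  proof (rule measure_eqI)
    show "sets M = sets N" using M N by simp
    fix X assume "X \<in> sets M"
    then have X: "X \<in> sets borel" "X \<inter> {0..} = X" using borel_nonneg_setsD[OF M(1)] by auto
    then show "emeasure M X = emeasure N X"
      using distr[OF M(1) X(1)] distr[OF N(1) X(1)] eq' by simp
  qed
qed

section \<open>The excess lifetime distribution\<close>

lemma sets_excess_lifetime: "sets (excess_lifetime \<theta>) = sets borel_nonneg"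
  by (simp add: excess_lifetime_def sets_restrict_space)

text \<open>A nonnegative variable with mean 0 vanishes almost surely, which the missing atom at 0
  rules out. Hence \<open>rate\<close> is a genuine inverse and not the default
  \<open>inverse 0 = 0\<close>.\<close>

lemma mean_pos:
  assumes "sets \<theta> = sets borel_nonneg" "prob_space \<theta>" "integrable \<theta> (\<lambda>x. x)" "measure \<theta> {0} = 0"
  shows "0 < (\<integral>x. x \<partial>\<theta>)"
proof -
  interpret prob_space \<theta> by fact
  have sp: "space \<theta> = {0..}" by (rule borel_nonneg_space) fact
  have nn: "AE x in \<theta>. 0 \<le> x" by (rule AE_I2) (simp add: sp)
  have "{0} \<in> sets \<theta>" by (rule borel_nonneg_setsI[OF assms(1)]) auto
  then have "AE x in \<theta>. x \<noteq> 0"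
    using assms(4) by (intro AE_I'[of "{0}"]) (auto simp: null_sets_def emeasure_eq_measure)
  have "\<not> (AE x in \<theta>. x = 0)"
  proof
    assume "AE x in \<theta>. x = 0"
    with \<open>AE x in \<theta>. x \<noteq> 0\<close> have "AE x in \<theta>. False" by eventually_elim simp
    then show False using not_empty by (simp add: AE_False)
  qed
  then have "(\<integral>x. x \<partial>\<theta>) \<noteq> 0"
    using integral_nonneg_eq_0_iff_AE[OF assms(3) nn] by simp
  moreover have "0 \<le> (\<integral>x. x \<partial>\<theta>)" by (rule integral_nonneg_AE[OF nn])
  ultimately show ?thesis by simp
qed

text \<open>The tail is monotone, hence Borel. For \<open>x < 0\<close> the set
  \<open>{x<..}\<close> is not in \<open>sets \<theta>\<close> and gets the default measure 0, which
  can break monotonicity, so the argument runs through the image measure on the line.\<close>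

lemma measurable_tail:
  assumes \<theta>: "sets \<theta> = sets borel_nonneg" "prob_space \<theta>"
  shows "(\<lambda>x. measure \<theta> {x<..}) \<in> borel_measurable (restrict_space lborel {0..})"
proof -
  define N where "N = distr \<theta> borel (\<lambda>x. x)"
  have id: "(\<lambda>x. x) \<in> measurable \<theta> borel" by (rule borel_nonneg_measurable_id[OF \<theta>(1)])
  interpret N: prob_space N unfolding N_def by (rule prob_space.prob_space_distr[OF \<theta>(2) id])
  have setsN: "sets N = sets borel" by (simp add: N_def)
  have "(\<lambda>x. - measure N {x<..}) \<in> borel_measurable borel"
    by (rule borel_measurable_mono)
       (auto intro!: monoI N.finite_measure_mono simp: setsN)
  then have "(\<lambda>x. measure N {x<..}) \<in> borel_measurable lborel"
    using borel_measurable_uminus by fastforce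
  then have "(\<lambda>x. measure N {x<..}) \<in> borel_measurable (restrict_space lborel {0..})"
    by (rule measurable_restrict_space1)
  moreover have "measure N {x<..} = measure \<theta> {x<..}" if "x \<ge> 0" for x
  proof -
    have "{x<..} \<inter> {0..} = {x<..}" using that by auto
    then show ?thesis
      unfolding N_def by (subst measure_distr[OF id]) (auto simp: borel_nonneg_space[OF \<theta>(1)])
  qed
  ultimately show ?thesis
    by (subst (asm) measurable_cong[of _ _ "\<lambda>x. measure \<theta> {x<..}"]) (auto simp: space_restrict_space)
qed

text \<open>Fubini for \<open>f' x\<close> on the region \<open>x < y\<close>: integrating over
  \<open>y\<close> first gives the tail of \<theta>, integrating over \<open>x\<close> first gives
  \<open>f y - f 0\<close>. Stated beyond \<open>test_class\<close> so that it also covers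
  \<open>f x = x\<close>, which yields the total mass.\<close>

lemma integral_excess_lifetime:
  fixes f f' :: "real \<Rightarrow> real"
  assumes \<theta>: "sets \<theta> = sets borel_nonneg" "prob_space \<theta>" "integrable \<theta> (\<lambda>x. x)"
    and der: "\<And>x. x \<ge> 0 \<Longrightarrow> (f has_real_derivative f' x) (at x within {0..})"
    and cont: "continuous_on {0..} f'" and bdd: "bounded (f' ` {0..})" and f0: "f 0 = 0"
  shows "(\<integral>x. f' x \<partial>excess_lifetime \<theta>) = rate \<theta> * (\<integral>x. f x \<partial>\<theta>)"
proof -
  define L where "L = restrict_space lborel {0 :: real..}"
  have setsL: "sets L = sets borel_nonneg" by (simp add: L_def sets_restrict_space)
  interpret \<theta>: prob_space \<theta> by fact
  interpret L: sigma_finite_measure L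
    unfolding L_def by (rule sigma_finite_measure_restrict_space[OF sigma_finite_lborel]) simp
  interpret pair_sigma_finite \<theta> L ..
  have sp: "space \<theta> = {0..}" "space L = {0..}"
    using borel_nonneg_space[OF \<theta>(1)] borel_nonneg_space[OF setsL] by auto
  obtain B where B: "\<And>x. x \<ge> 0 \<Longrightarrow> \<bar>f' x\<bar> \<le> B" using bdd by (auto simp: bounded_iff)
  have [measurable]: "f' \<in> borel_measurable L"
    by (rule borel_nonneg_measurable_continuous_on[OF setsL cont])
  have [measurable]: "(\<lambda>x. x) \<in> measurable \<theta> borel" "(\<lambda>x. x) \<in> measurable L borel"
    using borel_nonneg_measurable_id \<theta>(1) setsL by auto
  have [measurable]: "fst \<in> measurable (\<theta> \<Otimes>\<^sub>M L) borel" "snd \<in> measurable (\<theta> \<Otimes>\<^sub>M L) borel"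
    using measurable_compose[OF measurable_fst, of "\<lambda>x. x" \<theta> borel L]
      measurable_compose[OF measurable_snd, of "\<lambda>x. x" L borel \<theta>] by simp_all
  have intL: "set_integrable lborel {0..y} g" "(\<integral>x. indicator {..<y} x * g x \<partial>L) = (LBINT x:{0..y}. g x)"
      "integrable L (\<lambda>x. indicator {..<y} x * g x)"
    if g: "continuous_on {0..} g" for y and g :: "real \<Rightarrow> real"
  proof -
    show *: "set_integrable lborel {0..y} g"
      by (rule borel_integrable_atLeastAtMost') (auto intro: continuous_on_subset[OF g])
    \<comment> \<open>The half-open range, suited to swapping \<open>x < y\<close>, differs from
      \<open>{0..y}\<close> only in the Lebesgue null point \<open>y\<close>.\<close>
    have ae: "AE x in lborel. indicator {0..} x *\<^sub>R (indicator {..<y} x * g x) = indicator {0..y} x *\<^sub>R g x"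
      using AE_lborel_singleton[of y] by eventually_elim (auto simp: indicator_def)
    have m: "(\<lambda>x. indicator {0..} x *\<^sub>R (indicator {..<y} x * g x)) \<in> borel_measurable lborel"
    proof -
      have "(\<lambda>x. indicator {0..} x *\<^sub>R g x) \<in> borel_measurable borel"
        by (rule borel_measurable_continuous_on_indicator[OF _ g]) simp
      then have "(\<lambda>x. indicator {..<y} x * (indicator {0..} x *\<^sub>R g x)) \<in> borel_measurable borel"
        by measurable
      then show ?thesis by (simp add: mult_ac)
    qed
    show "(\<integral>x. indicator {..<y} x * g x \<partial>L) = (LBINT x:{0..y}. g x)"
      unfolding L_def set_lebesgue_integral_def
      by (subst integral_restrict_space) (use ae m * in \<open>auto intro!: integral_cong_AE simp: set_integrable_def\<close>)
    show "integrable L (\<lambda>x. indicator {..<y} x * g x)"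
      unfolding L_def
      by (subst integrable_restrict_space)
         (use ae m * integrable_cong_AE[OF m _ ae] in \<open>auto simp: set_integrable_def\<close>)
  qed
  have fubini: "integrable (\<theta> \<Otimes>\<^sub>M L) (\<lambda>(y, x). indicator {..<y} x * f' x)"
  proof (rule Fubini_integrable)
    have eq: "(\<lambda>(y, x). indicator {..<y} x * f' x) = (\<lambda>p. (if snd p < fst p then 1 else 0) * f' (snd p))"
      by (auto simp: indicator_def)
    show "(\<lambda>(y, x). indicator {..<y} x * f' x) \<in> borel_measurable (\<theta> \<Otimes>\<^sub>M L)"
      unfolding eq by measurable
    then have m: "(\<lambda>y. \<integral>x. norm (indicator {..<y} x * f' x) \<partial>L) \<in> borel_measurable \<theta>"
      using L.borel_measurable_lebesgue_integral[of "\<lambda>y x. norm (indicator {..<y} x * f' x)" \<theta>]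
      by (auto simp: case_prod_beta)
    \<comment> \<open>The finite mean of \<theta> makes this bound integrable, which is what Fubini
      requires.\<close>
    have "norm (\<integral>x. norm (indicator {..<y} x * f' x) \<partial>L) \<le> B * y" if "y \<ge> 0" for y
    proof -
      have "(\<integral>x. norm (indicator {..<y} x * f' x) \<partial>L) \<le> (\<integral>x. indicator {..<y} x * B \<partial>L)"
        by (rule integral_mono)
           (use intL(3)[of "\<lambda>_. B"] integrable_norm[OF intL(3)[OF cont]] B in
             \<open>auto simp: sp indicator_def\<close>)
      also have "\<dots> = B * y" using intL(2)[of "\<lambda>_. B" y] that by (simp add: set_lebesgue_integral_def)
      finally show ?thesis by simp
    qed
    then show "integrable \<theta> (\<lambda>y. \<integral>x. norm (case (y, x) of (y, x) \<Rightarrow> indicator {..<y} x * f' x) \<partial>L)"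
      unfolding prod.case
      by (intro Bochner_Integration.integrable_bound[of \<theta> "\<lambda>y. B * y", OF _ m] AE_I2
            order_trans[OF _ abs_ge_self[of "B * _", folded real_norm_def]] integrable_mult_right \<theta>(3)) (simp_all add: sp)
    show "AE y in \<theta>. integrable L (\<lambda>x. case (y, x) of (y, x) \<Rightarrow> indicator {..<y} x * f' x)"
      using intL(3)[OF cont] by simp
  qed
  have inner: "(\<integral>x. indicator {..<y} x * f' x \<partial>L) = f y" if "y \<ge> 0" for y
  proof -
    have "(LBINT x:{0..y}. f' x) = f y - f 0"
      unfolding set_lebesgue_integral_def
      by (rule integral_FTC_Icc[OF that])
         (use cont in \<open>auto intro!: DERIV_subset[OF der] intro: continuous_on_subset
            simp: has_real_derivative_iff_has_vector_derivative[symmetric]\<close>)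
    then show ?thesis using f0 by (simp add: intL(2)[OF cont])
  qed
  have tail: "(\<integral>y. indicator {..<y} x * f' x \<partial>\<theta>) = measure \<theta> {x<..} * f' x" if "x \<ge> 0" for x
  proof -
    have "{x<..} \<inter> space \<theta> = {x<..}" using that by (auto simp: sp)
    moreover have "(\<integral>y. indicator {..<y} x * f' x \<partial>\<theta>) = (\<integral>y. indicator {x<..} y * f' x \<partial>\<theta>)"
      by (rule Bochner_Integration.integral_cong) (auto simp: indicator_def)
    ultimately show ?thesis by simp
  qed
  have meas: "(\<lambda>x. measure \<theta> {x<..}) \<in> borel_measurable L"
    unfolding L_def by (rule measurable_tail[OF \<theta>(1,2)])
  have rate: "0 \<le> rate \<theta>" unfolding rate_def by (auto intro!: integral_nonneg_AE AE_I2 simp: sp)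
  have "(\<integral>x. f' x \<partial>excess_lifetime \<theta>) = (\<integral>x. rate \<theta> * measure \<theta> {x<..} * f' x \<partial>L)"
    unfolding excess_lifetime_def L_def[symmetric]
    by (subst integral_density) (use meas rate in auto)
  also have "\<dots> = rate \<theta> * (\<integral>x. (\<integral>y. indicator {..<y} x * f' x \<partial>\<theta>) \<partial>L)"
    unfolding mult.assoc integral_mult_right_zero
    by (rule arg_cong[of _ _ "(*) (rate \<theta>)"], rule Bochner_Integration.integral_cong[OF refl], subst tail)
       (simp_all add: sp)
  also have "(\<integral>x. (\<integral>y. indicator {..<y} x * f' x \<partial>\<theta>) \<partial>L) = (\<integral>y. (\<integral>x. indicator {..<y} x * f' x \<partial>L) \<partial>\<theta>)"
    by (rule Fubini_integral) (use fubini in simp)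
  also have "\<dots> = (\<integral>y. f y \<partial>\<theta>)"
    by (rule Bochner_Integration.integral_cong) (auto simp: inner sp)
  finally show ?thesis .
qed

text \<open>The total mass is \<open>rate\<close> times the mean, from \<open>f x = x\<close> and
  \<open>f' x = 1\<close>; the point 0 is null because the measure has a Lebesgue density.\<close>

lemma excess_lifetime_props:
  assumes "sets \<theta> = sets borel_nonneg" "prob_space \<theta>" "integrable \<theta> (\<lambda>x. x)" "measure \<theta> {0} = 0"
  shows prob_space_excess_lifetime: "prob_space (excess_lifetime \<theta>)"
    and excess_lifetime_singleton: "emeasure (excess_lifetime \<theta>) {0} = 0"
proof -
  have "(\<integral>x. 1 \<partial>excess_lifetime \<theta>) = rate \<theta> * (\<integral>x. x \<partial>\<theta>)"
    by (rule integral_excess_lifetime) (use assms in \<open>auto intro!: derivative_eq_intros simp: image_constant_conv\<close>)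
  then have "measure (excess_lifetime \<theta>) (space (excess_lifetime \<theta>)) = 1"
    using mean_pos[OF assms] by (simp add: rate_def)
  then show "prob_space (excess_lifetime \<theta>)"
    \<comment> \<open>An infinite \<open>emeasure\<close> would make \<open>measure\<close> the
      default 0, so the value 1 excludes it.\<close>
    by (intro prob_spaceI) (metis emeasure_eq_ennreal_measure ennreal_1 measure_zero_top zero_neq_one)
  have "emeasure (restrict_space lborel {0 :: real..}) {0} = 0"
    by (subst emeasure_restrict_space) auto
  moreover have "{0} \<in> sets (restrict_space lborel {0 :: real..})"
    by (rule borel_nonneg_setsI) (simp_all add: sets_restrict_space)
  ultimately have "{0} \<in> null_sets (restrict_space lborel {0 :: real..})"
    by (simp only: null_sets_def mem_Collect_eq simp_thms)
  moreover have "absolutely_continuous (restrict_space lborel {0..}) (excess_lifetime \<theta>)"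
    unfolding excess_lifetime_def
    by (intro absolutely_continuousI_density measurable_compose[OF _ measurable_ennreal]
        borel_measurable_times borel_measurable_const measurable_tail[OF assms(1,2)])
  ultimately have "{0} \<in> null_sets (excess_lifetime \<theta>)"
    unfolding absolutely_continuous_def by (rule rev_subsetD)
  then show "emeasure (excess_lifetime \<theta>) {0} = 0" by (rule null_setsD1)
qed

section \<open>Constant paths of the fluid model\<close>

lemma fin_measuresD:
  assumes "\<xi> \<in> fin_measures"
  shows "sets \<xi> = sets borel_nonneg" "finite_measure \<xi>" "space \<xi> = {0..}"
  using assms borel_nonneg_space by (auto simp: fin_measures_def)

lemma mass_nonneg: "0 \<le> mass \<xi> $ i"
  by (simp add: mass_def)

text \<open>Every integrand depends on time only through \<open>\<zeta> s\<close>, so each condition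
  reduces to a comparison of slopes. The path is fixed only for \<open>t \<ge> 0\<close>, as in
  \<open>invariant_state\<close>.\<close>

lemma fluid_model_solution_const_iff:
  fixes A :: "real^'i^'j::finite" and \<xi> :: "'i::finite \<Rightarrow> real measure"
  assumes fin: "\<forall>i. \<xi> i \<in> fin_measures" and \<zeta>: "\<forall>t\<ge>0. \<zeta> t = \<xi>"
  shows "fluid_model_solution A C \<Lambda> \<nu> \<theta> \<zeta> \<longleftrightarrow>
    (\<forall>i. measure (\<xi> i) {0} = 0) \<and>
    A *v (\<chi> i. if mass \<xi> $ i > 0 then \<Lambda> (mass \<xi>) $ i else load \<nu> \<theta> $ i) \<le> C \<and>
    (\<forall>(f, f') \<in> test_class. \<forall>i.
       (\<integral>x. f' x \<partial>\<xi> i) * (\<Lambda> (mass \<xi>) $ i / mass \<xi> $ i)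
         = \<nu> $ i * (\<integral>x. f x \<partial>\<theta> i) * indicator {0<..} (mass \<xi> $ i))"
    (is "_ \<longleftrightarrow> _ \<and> A *v ?a \<le> C \<and> _")
proof -
  have timeint: "(LBINT s:{0..t}. g (\<zeta> s)) = t * g \<xi>" if "t \<ge> 0" for t and g :: "('i \<Rightarrow> real measure) \<Rightarrow> real"
  proof -
    have "(LBINT s:{0..t}. g (\<zeta> s)) = (LBINT s:{0..t}. g \<xi>)"
      by (rule set_lebesgue_integral_cong) (use \<zeta> in auto)
    then show ?thesis using that by (simp add: set_lebesgue_integral_def)
  qed
  have "continuous_map (top_of_set {0..}) (product_topology (\<lambda>_. weak_topology) UNIV) (\<lambda>_. \<xi>)"
    using fin by (simp add: topspace_weak_topology PiE_iff)
  then have 1: "continuous_map (top_of_set {0..}) (product_topology (\<lambda>_. weak_topology) UNIV) \<zeta>"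
    by (rule continuous_map_eq) (use \<zeta> in auto)
  have "(\<integral>x. indicator {0} x \<partial>\<xi> i) = measure (\<xi> i) {0}" for i
    using fin fin_measuresD(3)[of "\<xi> i"] by simp
  then have 2: "(\<forall>t\<ge>0. infnorm ((\<chi> i. \<integral>x. indicator {0} x \<partial>\<zeta> t i) :: real^'i) = 0)
      \<longleftrightarrow> (\<forall>i. measure (\<xi> i) {0} = 0)"
    using \<zeta> by (auto simp: infnorm_eq_0 vec_eq_iff)
  have "cumulative_allocation \<Lambda> \<nu> \<theta> \<zeta> t = t *\<^sub>R ?a" if "t \<ge> 0" for t
  proof -
    \<comment> \<open>Thus the two indicators in the allocation are complementary, and their sum is
      the case distinction in \<open>?a\<close>.\<close>
    have "\<not> mass \<xi> $ i > 0 \<Longrightarrow> mass \<xi> $ i = 0" for i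
      using mass_nonneg[of \<xi> i] by linarith
    then show ?thesis
      unfolding cumulative_allocation_def
      by (subst timeint[OF that, where g = "\<lambda>\<xi>. \<Lambda> (mass \<xi>) $ _ * indicator {0<..} (mass \<xi> $ _)
        + load \<nu> \<theta> $ _ * indicator {0} (mass \<xi> $ _)"]) (auto simp: vec_eq_iff)
  qed
  then have u: "unused_capacity A C \<Lambda> \<nu> \<theta> \<zeta> t $ j = t * (C $ j - (A *v ?a) $ j)" if "t \<ge> 0" for t j
    using that by (simp add: unused_capacity_def matrix_vector_mult_scaleR right_diff_distrib)
  have "mono_on {0..} (\<lambda>t. unused_capacity A C \<Lambda> \<nu> \<theta> \<zeta> t $ j) \<longleftrightarrow> (A *v ?a) $ j \<le> C $ j" for j
  proof
    assume "mono_on {0..} (\<lambda>t. unused_capacity A C \<Lambda> \<nu> \<theta> \<zeta> t $ j)"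
    \<comment> \<open>Times 0 and 1 suffice to read off the sign of the slope.\<close>
    then have "unused_capacity A C \<Lambda> \<nu> \<theta> \<zeta> 0 $ j \<le> unused_capacity A C \<Lambda> \<nu> \<theta> \<zeta> 1 $ j"
      by (rule mono_onD) auto
    then show "(A *v ?a) $ j \<le> C $ j" by (simp add: u)
  qed (auto intro!: mono_onI mult_right_mono simp: u)
  then have 3: "(\<forall>j. mono_on {0..} (\<lambda>t. unused_capacity A C \<Lambda> \<nu> \<theta> \<zeta> t $ j)) \<longleftrightarrow> A *v ?a \<le> C"
    by (simp add: less_eq_vec_def)
  have 4: "(\<forall>t\<ge>0. (\<integral>x. f x \<partial>\<zeta> t i) = (\<integral>x. f x \<partial>\<zeta> 0 i)
          - (LBINT s:{0..t}. (\<integral>x. f' x \<partial>\<zeta> s i) * (\<Lambda> (mass (\<zeta> s)) $ i / mass (\<zeta> s) $ i))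
          + \<nu> $ i * (\<integral>x. f x \<partial>\<theta> i) * (LBINT s:{0..t}. indicator {0<..} (mass (\<zeta> s) $ i)))
      \<longleftrightarrow> (\<integral>x. f' x \<partial>\<xi> i) * (\<Lambda> (mass \<xi>) $ i / mass \<xi> $ i)
         = \<nu> $ i * (\<integral>x. f x \<partial>\<theta> i) * indicator {0<..} (mass \<xi> $ i)" (is "?L \<longleftrightarrow> ?d = ?b * ?e")
    for f f' :: "real \<Rightarrow> real" and i
  proof -
    have "?L \<longleftrightarrow> (\<forall>t\<ge>0. 0 = - (t * ?d) + ?b * (t * ?e))"
      using timeint[where g = "\<lambda>\<xi>. (\<integral>x. f' x \<partial>\<xi> i) * (\<Lambda> (mass \<xi>) $ i / mass \<xi> $ i)"]
        timeint[where g = "\<lambda>\<xi>. indicator {0<..} (mass \<xi> $ i)"] \<zeta>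
      by auto
    also have "\<dots> \<longleftrightarrow> ?d = ?b * ?e"
    proof
      assume "\<forall>t\<ge>0. 0 = - (t * ?d) + ?b * (t * ?e)"
      from this[rule_format, of 1] show "?d = ?b * ?e" by simp
    next
      assume "?d = ?b * ?e"
      then show "\<forall>t\<ge>0. 0 = - (t * ?d) + ?b * (t * ?e)" by (simp only:) (simp add: algebra_simps)
    qed
    finally show ?thesis .
  qed
  show ?thesis unfolding fluid_model_solution_def 2 3 4 using 1 by simp
qed

text \<open>The criterion for constant paths does not mention \<zeta>, so the existential quantifier
  over paths collapses to the path that is constant at all times.\<close>

lemma invariant_state_iff:
  fixes A :: "real^'i^'j::finite" and \<xi> :: "'i::finite \<Rightarrow> real measure"
  shows "invariant_state A C \<Lambda> \<nu> \<theta> \<xi> \<longleftrightarrow>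
    (\<forall>i. \<xi> i \<in> fin_measures \<and> measure (\<xi> i) {0} = 0) \<and>
    A *v (\<chi> i. if mass \<xi> $ i > 0 then \<Lambda> (mass \<xi>) $ i else load \<nu> \<theta> $ i) \<le> C \<and>
    (\<forall>(f, f') \<in> test_class. \<forall>i.
       (\<integral>x. f' x \<partial>\<xi> i) * (\<Lambda> (mass \<xi>) $ i / mass \<xi> $ i)
         = \<nu> $ i * (\<integral>x. f x \<partial>\<theta> i) * indicator {0<..} (mass \<xi> $ i))"
proof (cases "\<forall>i. \<xi> i \<in> fin_measures")
  case True
  define P where "P \<longleftrightarrow> fluid_model_solution A C \<Lambda> \<nu> \<theta> (\<lambda>_. \<xi>)"
  have "fluid_model_solution A C \<Lambda> \<nu> \<theta> \<zeta> \<longleftrightarrow> P" if "\<forall>t\<ge>0. \<zeta> t = \<xi>" for \<zeta>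
    unfolding P_def fluid_model_solution_const_iff[OF True that]
    by (subst fluid_model_solution_const_iff[OF True]) simp_all
  then have "invariant_state A C \<Lambda> \<nu> \<theta> \<xi> \<longleftrightarrow> P"
    unfolding invariant_state_def P_def using True by (metis (no_types))
  then show ?thesis
    unfolding P_def fluid_model_solution_const_iff[OF True, of "\<lambda>_. \<xi>", simplified]
    using True by simp
qed (auto simp: invariant_state_def)

section \<open>Solving the stationary equation in one coordinate\<close>

lemma scale_measure_eq_density: "scale_measure r M = density M (\<lambda>_. r)"
  by (rule measure_eqI) (simp_all add: emeasure_density_const)

lemma integral_scale_measure:
  fixes g :: "'a \<Rightarrow> real"
  assumes "0 \<le> c" "g \<in> borel_measurable M"
  shows "(\<integral>x. g x \<partial>scale_measure (ennreal c) M) = c * (\<integral>x. g x \<partial>M)"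
  unfolding scale_measure_eq_density using assms by (subst integral_density) auto

lemma finite_measure_scale_measure:
  "finite_measure M \<Longrightarrow> finite_measure (scale_measure (ennreal c) M)"
  by (rule finite_measureI)
     (simp add: space_scale_measure ennreal_mult_eq_top_iff finite_measure.emeasure_eq_measure)

lemma test_class_measurable:
  assumes "(f, f') \<in> test_class" "sets M = sets borel_nonneg"
  shows "f' \<in> borel_measurable M"
  using assms by (intro borel_nonneg_measurable_continuous_on) (auto simp: test_class_def Cb1_def)

lemma rate_pos:
  assumes "sets \<theta> = sets borel_nonneg" "prob_space \<theta>" "integrable \<theta> (\<lambda>x. x)" "measure \<theta> {0} = 0"
  shows "0 < rate \<theta>"
  using mean_pos[OF assms] by (simp add: rate_def)

lemma integral_excess_lifetime_test_class:
  assumes "sets \<theta> = sets borel_nonneg" "prob_space \<theta>" "integrable \<theta> (\<lambda>x. x)" "(f, f') \<in> test_class"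
  shows "(\<integral>x. f' x \<partial>excess_lifetime \<theta>) = rate \<theta> * (\<integral>x. f x \<partial>\<theta>)"
  by (rule integral_excess_lifetime[OF assms(1-3)])
     (use assms(4) in \<open>auto simp: test_class_def Cb1_def\<close>)

text \<open>Here \<open>z\<close>, \<open>l\<close> and \<open>n\<close> stand for the mass, the
  allocation and the arrival rate of a single coordinate.\<close>

lemma stationary_measure_unique:
  assumes \<theta>: "sets \<theta> = sets borel_nonneg" "prob_space \<theta>" "integrable \<theta> (\<lambda>x. x)" "measure \<theta> {0} = 0"
    and \<xi>: "\<xi> \<in> fin_measures" "measure \<xi> {0} = 0"
    and z: "measure \<xi> (space \<xi>) = z" "0 < z" and l: "0 \<le> l" and n: "0 < n"
    and eq: "\<And>f f'. (f, f') \<in> test_class \<Longrightarrow> (\<integral>x. f' x \<partial>\<xi>) * (l / z) = n * (\<integral>x. f x \<partial>\<theta>)"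
  shows "l = n / rate \<theta>" "\<xi> = scale_measure (ennreal z) (excess_lifetime \<theta>)"
proof -
  define e where "e = excess_lifetime \<theta>"
  interpret e: prob_space e unfolding e_def by (rule prob_space_excess_lifetime[OF \<theta>])
  note sets_e = sets_excess_lifetime[of \<theta>, folded e_def]
  note r = rate_pos[OF \<theta>]
  note \<xi>' = fin_measuresD[OF \<xi>(1)]
  have nr: "0 \<le> n / rate \<theta>" using n r by simp
  have eqm: "scale_measure (ennreal (l / z)) \<xi> = scale_measure (ennreal (n / rate \<theta>)) e"
  proof (rule measure_eq_if_test_class_eq)
    fix f f' assume f: "(f, f') \<in> test_class"
    have "(\<integral>x. f' x \<partial>scale_measure (ennreal (l / z)) \<xi>) = (\<integral>x. f' x \<partial>\<xi>) * (l / z)"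
      using l z test_class_measurable[OF f \<xi>'(1)] by (simp add: integral_scale_measure)
    also have "\<dots> = n / rate \<theta> * (\<integral>x. f' x \<partial>e)"
      using eq[OF f] integral_excess_lifetime_test_class[OF \<theta>(1-3) f, folded e_def] r by simp
    also have "\<dots> = (\<integral>x. f' x \<partial>scale_measure (ennreal (n / rate \<theta>)) e)"
      using nr test_class_measurable[OF f sets_e] by (simp add: integral_scale_measure)
    finally show "(\<integral>x. f' x \<partial>scale_measure (ennreal (l / z)) \<xi>) = (\<integral>x. f' x \<partial>scale_measure (ennreal (n / rate \<theta>)) e)" .
  qed (use \<xi> \<xi>' sets_e l z nr excess_lifetime_singleton[OF \<theta>, folded e_def] e.finite_measure_axioms
        in \<open>auto simp: finite_measure_scale_measure e.emeasure_eq_measure\<close>)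
  \<comment> \<open>Total masses: \<xi> has mass \<open>z\<close> and \<open>e\<close> has mass
    1.\<close>
  have "l / z * measure \<xi> {0..} = n / rate \<theta> * measure e {0..}"
    using arg_cong[OF eqm, of "\<lambda>M. measure M {0..}"] l z nr by simp
  moreover have "measure e {0..} = 1" using e.prob_space borel_nonneg_space[OF sets_e] by simp
  ultimately show l_eq: "l = n / rate \<theta>" using z \<xi>' by simp
  \<comment> \<open>Only now is \<open>l\<close> known to be nonzero, so that \<open>eqm\<close> may
    be rescaled by \<open>z / l\<close>.\<close>
  then have "0 < l" using n r by simp
  then have "ennreal (z / l) * ennreal (l / z) = 1" "ennreal (z / l) * ennreal l = ennreal z"
    using z by (simp_all flip: ennreal_mult)
  then show "\<xi> = scale_measure (ennreal z) (excess_lifetime \<theta>)"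
    using arg_cong[OF eqm, of "scale_measure (ennreal (z / l))"] l_eq by (simp add: e_def)
qed

text \<open>Serves the coordinates of mass 0: there the stationary equation reads
  \<open>0 = 0\<close>, and the claimed measure has scale factor 0.\<close>

lemma null_measure_unique:
  assumes "finite_measure M" "measure M (space M) = 0" "sets M = sets N"
  shows "M = null_measure N"
proof (rule measure_eqI)
  fix X assume "X \<in> sets M"
  then have "emeasure M X \<le> emeasure M (space M)" by (intro emeasure_mono sets.sets_into_space) auto
  then show "emeasure M X = emeasure (null_measure N) X"
    using assms by (simp add: finite_measure.emeasure_eq_measure)
qed (use assms in simp)

lemma alpha_fair_policy_nonneg:
  assumes "alpha_fair_policy A C \<alpha> \<kappa> \<Lambda>" "0 \<le> z"
  shows "0 \<le> \<Lambda> z $ i"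
proof -
  have "\<Lambda> z \<in> admissible z"
    using assms unfolding alpha_fair_policy_def is_arg_max_def by blast
  then show ?thesis by (simp add: admissible_def less_eq_vec_def)
qed

section \<open>Characterization of the invariant states\<close>

theorem theorem6p3:
  fixes A :: "real^'i^'j" and C :: "real^'j" and \<nu> \<kappa> :: "real^'i" and \<alpha> :: real
    and \<theta> :: "'i \<Rightarrow> real measure" and \<Lambda> :: "real^'i \<Rightarrow> real^'i"
  assumes A_entries: "\<forall>j i. A $ j $ i \<in> {0, 1}"
    and A_columns: "\<forall>i. \<exists>j. A $ j $ i \<noteq> 0"
    and C_pos: "\<forall>j. C $ j > 0"
    and nu_pos: "\<forall>i. \<nu> $ i > 0"
    and theta_borel: "\<forall>i. sets (\<theta> i) = sets borel_nonneg"
    and theta_prob: "\<forall>i. prob_space (\<theta> i)"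
    and theta_mean: "\<forall>i. integrable (\<theta> i) (\<lambda>x. x)"
    and theta_zero: "\<forall>i. measure (\<theta> i) {0} = 0"
    and alpha_pos: "\<alpha> > 0"
    and kappa_pos: "\<forall>i. \<kappa> $ i > 0"
    and policy: "alpha_fair_policy A C \<alpha> \<kappa> \<Lambda>"
  shows "((\<exists>\<xi>. invariant_state A C \<Lambda> \<nu> \<theta> \<xi>) \<longleftrightarrow> A *v load \<nu> \<theta> \<le> C) \<and>
         (A *v load \<nu> \<theta> \<le> C \<longrightarrow>
            {\<xi>. invariant_state A C \<Lambda> \<nu> \<theta> \<xi>} = invariant_manifold \<Lambda> \<nu> \<theta>)"
proof -
  have \<theta>: "sets (\<theta> i) = sets borel_nonneg" "prob_space (\<theta> i)" "integrable (\<theta> i) (\<lambda>x. x)"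
      "measure (\<theta> i) {0} = 0" for i
    using theta_borel theta_prob theta_mean theta_zero by auto
  have load: "load \<nu> \<theta> $ i = \<nu> $ i / rate (\<theta> i)" for i by (simp add: load_def)
  have necessary: "A *v load \<nu> \<theta> \<le> C \<and> \<xi> \<in> invariant_manifold \<Lambda> \<nu> \<theta>"
    if inv: "invariant_state A C \<Lambda> \<nu> \<theta> \<xi>" for \<xi>
  proof -
    define z where "z = mass \<xi>"
    have z: "measure (\<xi> i) (space (\<xi> i)) = z $ i" for i by (simp add: z_def mass_def)
    have z0: "0 \<le> z $ i" for i by (simp add: z_def mass_nonneg)
    then have z0': "0 \<le> z" by (simp add: less_eq_vec_def)
    note inv' = inv[unfolded invariant_state_iff, folded z_def]
    have fin: "\<xi> i \<in> fin_measures" and zero: "measure (\<xi> i) {0} = 0" for i using inv' by auto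
    have pos: "\<Lambda> z $ i = load \<nu> \<theta> $ i" "\<xi> i = scale_measure (ennreal (z $ i)) (excess_lifetime (\<theta> i))"
      if "z $ i > 0" for i
    proof -
      have "(\<integral>x. f' x \<partial>\<xi> i) * (\<Lambda> z $ i / z $ i) = \<nu> $ i * (\<integral>x. f x \<partial>\<theta> i)"
        if "(f, f') \<in> test_class" for f f'
        using inv' that \<open>z $ i > 0\<close> by force
      from stationary_measure_unique[OF \<theta> fin zero z \<open>z $ i > 0\<close> alpha_fair_policy_nonneg[OF policy z0']
          nu_pos[rule_format] this]
      show "\<Lambda> z $ i = load \<nu> \<theta> $ i" "\<xi> i = scale_measure (ennreal (z $ i)) (excess_lifetime (\<theta> i))"
        by (simp_all add: load)
    qed
    have "\<xi> i = scale_measure (ennreal (z $ i)) (excess_lifetime (\<theta> i))" for i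
    proof (cases "z $ i > 0")
      case False
      then have "z $ i = 0" using z0[of i] by simp
      then show ?thesis
        using null_measure_unique[of "\<xi> i" "excess_lifetime (\<theta> i)"] z[of i] fin_measuresD[OF fin[of i]]
        by (simp add: sets_excess_lifetime)
    qed (rule pos)
    then have "\<xi> \<in> invariant_manifold \<Lambda> \<nu> \<theta>"
      using fin z0' pos(1) by (auto simp: invariant_manifold_def equilibrium_masses_def)
    \<comment> \<open>Coordinates of mass 0 receive the load by definition of the allocation
      process, the others by \<open>pos\<close>; the capacity condition thus becomes the one in the
      claim.\<close>
    moreover have "(\<chi> i. if z $ i > 0 then \<Lambda> z $ i else load \<nu> \<theta> $ i) = load \<nu> \<theta>"
      using pos(1) by (simp add: vec_eq_iff)
    ultimately show ?thesis using inv' by simp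
  qed
  have sufficient: "invariant_state A C \<Lambda> \<nu> \<theta> \<xi>"
    if cap: "A *v load \<nu> \<theta> \<le> C" and \<xi>: "\<xi> \<in> invariant_manifold \<Lambda> \<nu> \<theta>" for \<xi>
  proof -
    obtain z where fin: "\<And>i. \<xi> i \<in> fin_measures" and z: "0 \<le> z"
      and \<Lambda>: "\<And>i. z $ i > 0 \<Longrightarrow> \<Lambda> z $ i = load \<nu> \<theta> $ i"
      and eq: "\<And>i. \<xi> i = scale_measure (ennreal (z $ i)) (excess_lifetime (\<theta> i))"
      using \<xi> unfolding invariant_manifold_def equilibrium_masses_def by blast
    have z0: "0 \<le> z $ i" for i using z by (simp add: less_eq_vec_def)
    have mass: "mass \<xi> = z"
    proof (rule vec_eq_iff[THEN iffD2], rule allI)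
      fix i
      show "mass \<xi> $ i = z $ i"
        using prob_space.prob_space[OF prob_space_excess_lifetime[OF \<theta>, of i]] z0[of i]
        by (simp add: mass_def eq space_scale_measure)
    qed
    have "measure (\<xi> i) {0} = 0" for i
      using excess_lifetime_singleton[OF \<theta>, of i] z0[of i] by (simp add: eq measure_def)
    moreover have "(\<chi> i. if z $ i > 0 then \<Lambda> z $ i else load \<nu> \<theta> $ i) = load \<nu> \<theta>"
      using \<Lambda> by (simp add: vec_eq_iff)
    moreover have "(\<integral>x. f' x \<partial>\<xi> i) * (\<Lambda> z $ i / z $ i) = \<nu> $ i * (\<integral>x. f x \<partial>\<theta> i) * indicator {0<..} (z $ i)"
      if f: "(f, f') \<in> test_class" for f f' i
    proof (cases "z $ i > 0")
      case True
      have "(\<integral>x. f' x \<partial>\<xi> i) = z $ i * (rate (\<theta> i) * (\<integral>x. f x \<partial>\<theta> i))"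
        unfolding eq using integral_excess_lifetime_test_class[OF \<theta>(1-3) f, of i]
        by (subst integral_scale_measure[OF z0 test_class_measurable[OF f sets_excess_lifetime]]) simp
      \<comment> \<open>The factors \<open>z $ i\<close> cancel, and load times rate is
        \<open>\<nu> $ i\<close>.\<close>
      then show ?thesis using True \<Lambda>[OF True] rate_pos[OF \<theta>, of i] by (simp add: load)
    next
      case False
      \<comment> \<open>Both sides vanish, the left one through division by zero.\<close>
      then have "z $ i = 0" using z0[of i] by simp
      then show ?thesis by simp
    qed
    ultimately show ?thesis using fin cap unfolding invariant_state_iff mass by auto
  qed
  \<comment> \<open>The mass vector 0 satisfies the equilibrium condition vacuously, so the manifold
    is never empty; this yields existence once the capacity condition holds.\<close>
  have "(\<lambda>i. scale_measure (ennreal 0) (excess_lifetime (\<theta> i))) \<in> invariant_manifold \<Lambda> \<nu> \<theta>"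
  proof -
    have "scale_measure (ennreal 0) (excess_lifetime (\<theta> i)) \<in> fin_measures" for i
      using finite_measure_scale_measure[OF prob_space.finite_measure[OF prob_space_excess_lifetime[OF \<theta>]], of 0 i]
      by (simp add: fin_measures_def sets_excess_lifetime)
    then show ?thesis
      by (auto simp: invariant_manifold_def equilibrium_masses_def intro!: bexI[of _ 0])
  qed
  then show ?thesis using necessary sufficient by blast
qed

end
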